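(* Consider the implicit-explicit fully discrete scheme O2IMEX-MultiD for the two-fluid relativistic plasma flow equations: let $\beta=1-\frac1{\sqrt2}$, $\Delta t>0$, and let admissible cell values $\mathbf{U}^n_{i,j},\mathbf{U}^{(1)}_{i,j},\mathbf{U}^{(2)}_{i,j}$ and values $\mathbf{U}^{n+1}_{i,j}$ satisfy, for $0\le i<N_x$, $0\le j<N_y$, $$\mathbf{U}^{(1)}_{i,j}=\mathbf{U}^n_{i,j}+\Delta t\,\beta\,\mathcal{S}(\mathbf{U}^{(1)}_{i,j}),$$ $$\mathbf{U}^{(2)}_{i,j}=\mathbf{U}^n_{i,j}+\Delta t\left[\mathcal{L}_{i,j}(\mathbf{U}^{(1)})+(1-2\beta)\,\mathcal{S}(\mathbf{U}^{(1)}_{i,j})+\beta\,\mathcal{S}(\mathbf{U}^{(2)}_{i,j})\right],$$ $$\mathbf{U}^{n+1}_{i,j}=\mathbf{U}^n_{i,j}+\tfrac12\Delta t\left[\mathcal{L}_{i,j}(\mathbf{U}^{(1)})+\mathcal{L}_{i,j}(\mathbf{U}^{(2)})+\mathcal{S}(\mathbf{U}^{(1)}_{i,j})+\mathcal{S}(\mathbf{U}^{(2)}_{i,j})\right],$$ where $$\mathcal{L}_{i,j}(\mathbf{U})=-\frac1{\Delta x}\left(\mathbf{F}^x_{i+\frac12,j}-\mathbf{F}^x_{i-\frac12,j}\right)-\frac1{\Delta y}\left(\mathbf{F}^y_{i,j+\frac12}-\mathbf{F}^y_{i,j-\frac12}\right)$$ with the numerical fluxes and source defined in the context. Then, for every vertex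 with $0\le i\le N_x-2$, $0\le j\le N_y-2$, the magnetic field satisfies $$\left(\nabla \cdot \mathbf{B}^{n+1}\right)_{i+\frac12,j+\frac12} = \left(\nabla \cdot \mathbf{B}^n\right)_{i+\frac12,j+\frac12}$$ and the electric field satisfies $$\left(\nabla \cdot \mathbf{E}^{n+1}\right)_{i+\frac12,j+\frac12} = \left(\nabla \cdot \mathbf{E}^n\right)_{i+\frac12,j+\frac12} -\frac{\Delta t}{2} \left( \left(\nabla \cdot \mathbf{J}^{(1)}\right)_{i+\frac12,j+\frac12} + \left(\nabla \cdot \mathbf{J}^{(2)}\right)_{i+\frac12,j+\frac12}\right),$$ where $\mathbf{J}^{(1)}$ and $\mathbf{J}^{(2)}$ are the current densities evaluated cellwise at $\mathbf{U}^{(1)}$ and $\mathbf{U}^{(2)}$ (these are consistent with the continuous identities $\partial_t(\nabla\cdot\mathbf{B})=0$ and $\partial_t(\nabla\cdot\mathbf{E})=-\nabla\cdot\mathbf{J}$).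
   Context: **Unknowns.** Two fluid species $\alpha\in\{i,e\}$ (ions, electrons) with primitive variables: density $\rho_\alpha>0$, pressure $p_\alpha>0$, velocity $\mathbf{u}_\alpha=(u^x_\alpha,u^y_\alpha,u^z_\alpha)$, $|\mathbf{u}_\alpha|<1$. Constants: $\gamma_\alpha\in(1,2]$ and charge-to-mass ratios $r_\alpha\in\mathbb{R}$. Put $\Gamma_\alpha=(1-|\mathbf{u}_\alpha|^2)^{-1/2}$, $h_\alpha=1+\frac{\gamma_\alpha}{\gamma_\alpha-1}\frac{p_\alpha}{\rho_\alpha}$, $D_\alpha=\rho_\alpha\Gamma_\alpha$, $\mathbf{m}_\alpha=(m_\alpha^x,m_\alpha^y,m_\alpha^z)=\rho_\alpha h_\alpha\Gamma_\alpha^2\mathbf{u}_\alpha$, $\mathcal{E}_\alpha=\rho_\alpha h_\alpha\Gamma_\alpha^2-p_\alpha$ (total energy density). The conservative vector is $\mathbf{U}=(\mathbf{U}_i,\mathbf{U}_e,\mathbf{U}_m)\in\mathbb{R}^{16}$, $\mathbf{U}_\alpha=(D_\alpha,\mathbf{m}_\alpha,\mathcal{E}_\alpha)$, $\mathbf{U}_m=(\mathbf{B},\mathbf{E})=(B_x,B_y,B_z,E_x,E_y,E_z)$. A state is admissible if its fluid parts come from primitive variables satisfying the inequalities above. The current density is $\mathbf{J}=(J_x,J_y,J_z)=\sum_{\alpha}r_\alpha\rho_\alpha\Gamma_\alpha\mathbf{u}_\alpha$. Superscripts $n$, $(k)$, $n+1$ on $\mathbf{B},\mathbf{E},\mathbf{J}$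 indicate the state $\mathbf{U}^n,\mathbf{U}^{(k)},\mathbf{U}^{n+1}$ they belong to. **Source.** $\mathcal{S}=(\mathcal{S}_i,\mathcal{S}_e,\mathcal{S}_m)$ with $\mathcal{S}_\alpha=\big(0,\ r_\alpha D_\alpha(\mathbf{E}+\mathbf{u}_\alpha\times\mathbf{B}),\ r_\alpha D_\alpha\,\mathbf{u}_\alpha\cdot\mathbf{E}\big)$ and $\mathcal{S}_m=(0,0,0,-J_x,-J_y,-J_z)$. **Mesh.** Uniform rectangular mesh of $[a,b]\times[c,d]$ with cells of size $\Delta x\times\Delta y$, centers $x_i=a+(i+\frac12)\Delta x$, $y_j=c+(j+\frac12)\Delta y$, $0\le i<N_x$, $0\le j<N_y$; vertices $(x_{i+\frac12},y_{j+\frac12})$, $x_{i+\frac12}=\frac{x_i+x_{i+1}}2$, $y_{j+\frac12}=\frac{y_j+y_{j+1}}2$. (The species label $i$ and the cell index $i$ are unrelated.) The scheme is imposed in every cell of the grid; values (at each stage) in cells outside the grid (ghost cells) needed by the stencils are prescribed by the boundary conditions and may be arbitrary. **Fluxes** (evaluated from the state $\mathbf{U}$ that is the argument of $\mathcal{L}_{i,j}$). $\mathbf{F}^d=(\mathbf{F}^d_i,\mathbf{F}^d_e,\mathbf{F}^d_m)$, $d\in\{x,y\}$. The fluid fluxes $\mathbf{F}^d_\alpha$ are any numerical fluxes consistent with $\mathbf{f}_\alpha^x=(D_\alpha u_\alpha^x, m_\alpha^xu_\alpha^x+p_\alpha, m_\alpha^yu_\alpha^x,m_\alpha^zu_\alpha^x,m_\alpha^x)$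 and $\mathbf{f}_\alpha^y=(D_\alpha u_\alpha^y, m_\alpha^xu_\alpha^y, m_\alpha^yu_\alpha^y+p_\alpha,m_\alpha^zu_\alpha^y,m_\alpha^y)$. The Maxwell fluxes are $$\mathbf{F}_{m,i+\frac12,j}^x=\Big(0,\ -\tfrac12(\tilde E_{z,i+\frac12,j+\frac12}+\tilde E_{z,i+\frac12,j-\frac12}),\ \tilde F^{x,3}_{m,i+\frac12,j},\ 0,\ \tfrac12(\tilde B_{z,i+\frac12,j+\frac12}+\tilde B_{z,i+\frac12,j-\frac12}),\ \tilde F^{x,6}_{m,i+\frac12,j}\Big),$$ $$\mathbf{F}_{m,i,j+\frac12}^y=\Big(\tfrac12(\tilde E_{z,i+\frac12,j+\frac12}+\tilde E_{z,i-\frac12,j+\frac12}),\ 0,\ \tilde F^{y,3}_{m,i,j+\frac12},\ -\tfrac12(\tilde B_{z,i+\frac12,j+\frac12}+\tilde B_{z,i-\frac12,j+\frac12}),\ 0,\ \tilde F^{y,6}_{m,i,j+\frac12}\Big).$$ **MinMod** (componentwise): $\mathrm{MinMod}(a,b,c)=\mathrm{sign}(b-a)\min\{|c-b|,|b-a|\}$ if $\mathrm{sign}(b-a)=\mathrm{sign}(c-b)$, and $0$ otherwise. **Vertex values.** At vertex $(i+\frac12,j+\frac12)$, dropping the subscript $m$ on $\mathbf{U}_m$, the diagonal reconstructions are $\hat{\mathbf{U}}^{SW}=\mathbf{U}_{i,j}+\frac12\mathrm{MinMod}(\mathbf{U}_{i-1,j-1},\mathbf{U}_{i,j},\mathbf{U}_{i+1,j+1})$,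 $\hat{\mathbf{U}}^{SE}=\mathbf{U}_{i+1,j}+\frac12\mathrm{MinMod}(\mathbf{U}_{i+2,j-1},\mathbf{U}_{i+1,j},\mathbf{U}_{i,j+1})$, $\hat{\mathbf{U}}^{NE}=\mathbf{U}_{i+1,j+1}+\frac12\mathrm{MinMod}(\mathbf{U}_{i+2,j+2},\mathbf{U}_{i+1,j+1},\mathbf{U}_{i,j})$, $\hat{\mathbf{U}}^{NW}=\mathbf{U}_{i,j+1}+\frac12\mathrm{MinMod}(\mathbf{U}_{i-1,j+2},\mathbf{U}_{i,j+1},\mathbf{U}_{i+1,j})$, and, with all hatted quantities taken at $(i+\frac12,j+\frac12)$, $$\tilde E_{z,i+\frac12,j+\frac12}=\tfrac14(\hat E_z^{SW}+\hat E_z^{SE}+\hat E_z^{NE}+\hat E_z^{NW})+\tfrac14(\hat B_y^{SE}+\hat B_y^{NE}-\hat B_y^{SW}-\hat B_y^{NW})-\tfrac14(\hat B_x^{NW}+\hat B_x^{NE}-\hat B_x^{SW}-\hat B_x^{SE}),$$ $$\tilde B_{z,i+\frac12,j+\frac12}=\tfrac14(\hat B_z^{SW}+\hat B_z^{SE}+\hat B_z^{NE}+\hat B_z^{NW})-\tfrac14(\hat E_x^{NW}+\hat E_x^{NE}-\hat E_x^{SW}-\hat E_x^{SE})+\tfrac14(\hat E_y^{SE}+\hat E_y^{NE}-\hat E_y^{SW}-\hat E_y^{NW}).$$ **One-dimensional components.** With $\mathbf{U}^-_{i+\frac12,j}=\mathbf{U}_{i,j}+\frac12\mathrm{MinMod}(\mathbf{U}_{i-1,j},\mathbf{U}_{i,j},\mathbf{U}_{i+1,j})$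 and $\mathbf{U}^+_{i+\frac12,j}=\mathbf{U}_{i+1,j}-\frac12\mathrm{MinMod}(\mathbf{U}_{i,j},\mathbf{U}_{i+1,j},\mathbf{U}_{i+2,j})$ (for $\mathbf{U}_m$), set $\tilde F^{x,3}_m=\frac12(E_y^-+E_y^+)-\frac12(B_z^+-B_z^-)$ and $\tilde F^{x,6}_m=-\frac12(B_y^-+B_y^+)-\frac12(E_z^+-E_z^-)$ at $(i+\frac12,j)$; analogously, with traces $\mathbf{U}^\pm_{i,j+\frac12}$ reconstructed in the $y$-direction, $\tilde F^{y,3}_m=-\frac12(E_x^-+E_x^+)-\frac12(B_z^+-B_z^-)$ and $\tilde F^{y,6}_m=\frac12(B_x^-+B_x^+)-\frac12(E_z^+-E_z^-)$ at $(i,j+\frac12)$. **Discrete divergence** of a grid vector function $\mathbf{A}=(A_x,A_y,A_z)$ at a vertex: $$(\nabla\cdot\mathbf{A})_{i+\frac12,j+\frac12}=\frac12\left(\frac{A_{x,i+1,j+1}-A_{x,i,j+1}}{\Delta x}+\frac{A_{x,i+1,j}-A_{x,i,j}}{\Delta x}\right)+\frac12\left(\frac{A_{y,i+1,j+1}-A_{y,i+1,j}}{\Delta y}+\frac{A_{y,i,j+1}-A_{y,i,j}}{\Delta y}\right).$$ *)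

theory Defs
  imports "HOL-Analysis.Analysis"
begin

datatype species = Ion | Electron

record prim =
  rho :: real
  vel :: "real^3"
  pres :: real

text \<open>
  Conservative variables: a fluid part is \<open>(D, m, \<E>)\<close>, the Maxwell part is \<open>(B, E)\<close>, and a
  state is \<open>(U\<^sub>i, U\<^sub>e, U\<^sub>m)\<close>, that is, 5 + 5 + 6 = 16 real components.
\<close>

type_synonym fluid = "real \<times> (real^3) \<times> real"
type_synonym maxwell = "(real^3) \<times> (real^3)"
type_synonym state = "fluid \<times> fluid \<times> maxwell"

text \<open>
  Cell \<open>(i, j)\<close> carries the integer indices \<open>i, j\<close>; cells outside the mesh are ghost cells.
  A half-integer index \<open>i + 1/2\<close> is represented by the integer \<open>i\<close>.
\<close>

type_synonym 'a grid = "int \<Rightarrow> int \<Rightarrow> 'a"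

fun fluid_part :: "species \<Rightarrow> state \<Rightarrow> fluid" where
  "fluid_part Ion (Ui, Ue, Um) = Ui"
| "fluid_part Electron (Ui, Ue, Um) = Ue"

definition maxwell_part :: "state \<Rightarrow> maxwell" where
  "maxwell_part U = snd (snd U)"

definition B_field :: "state \<Rightarrow> real^3" where
  "B_field U = fst (maxwell_part U)"

definition E_field :: "state \<Rightarrow> real^3" where
  "E_field U = snd (maxwell_part U)"

definition lorentz :: "prim \<Rightarrow> real" where
  "lorentz P = 1 / sqrt (1 - (norm (vel P))\<^sup>2)"

definition enthalpy :: "real \<Rightarrow> prim \<Rightarrow> real" where
  "enthalpy \<gamma> P = 1 + \<gamma> / (\<gamma> - 1) * (pres P / rho P)"

definition cons_of_prim :: "real \<Rightarrow> prim \<Rightarrow> fluid" where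
  "cons_of_prim \<gamma> P =
    (rho P * lorentz P,
     (rho P * enthalpy \<gamma> P * (lorentz P)\<^sup>2) *\<^sub>R vel P,
     rho P * enthalpy \<gamma> P * (lorentz P)\<^sup>2 - pres P)"

definition admissible_prim :: "prim \<Rightarrow> bool" where
  "admissible_prim P \<longleftrightarrow> rho P > 0 \<and> pres P > 0 \<and> norm (vel P) < 1"

definition admissible :: "(species \<Rightarrow> real) \<Rightarrow> state \<Rightarrow> bool" where
  "admissible \<gamma> U \<longleftrightarrow>
    (\<forall>\<alpha>. \<exists>P. admissible_prim P \<and> cons_of_prim (\<gamma> \<alpha>) P = fluid_part \<alpha> U)"

definition prim_of :: "real \<Rightarrow> fluid \<Rightarrow> prim" where
  "prim_of \<gamma> W = (THE P. admissible_prim P \<and> cons_of_prim \<gamma> P = W)"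

text \<open>
  The conservative variables determine the primitive ones, so the description in
  \<open>prim_of\<close> is meaningful on every admissible state (\<open>prim_of_cons_of_prim\<close> below).
\<close>

lemma cons_of_prim_eqs:
  assumes P: "admissible_prim P" and \<gamma>: "1 < \<gamma>" and W: "cons_of_prim \<gamma> P = (D, m, e)"
  defines "H \<equiv> e + pres P"
  shows "H > 0" "D > 0" "m = H *\<^sub>R vel P" "norm m < H"
    "rho P = D * sqrt (1 - (norm m / H)\<^sup>2)"
    "D * sqrt (1 - (norm m / H)\<^sup>2) + \<gamma> / (\<gamma> - 1) * pres P = H - (norm m)\<^sup>2 / H"
proof -
  let ?v = "norm (vel P)"
  let ?L = "lorentz P"
  have r: "rho P > 0" and p: "pres P > 0" and v: "?v < 1"
    using P by (auto simp: admissible_prim_def)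
  have v2: "?v\<^sup>2 < 1"
    using v by (simp add: power_less_one_iff abs_square_less_1)
  have L: "?L > 0" and L1: "?L * sqrt (1 - ?v\<^sup>2) = 1"
    using v2 by (auto simp: lorentz_def)
  have L2: "?L\<^sup>2 * (1 - ?v\<^sup>2) = 1"
    using v2 by (simp add: lorentz_def power_divide)
  have h: "rho P * enthalpy \<gamma> P = rho P + \<gamma> / (\<gamma> - 1) * pres P"
    using r by (simp add: enthalpy_def distrib_left)
  have hpos: "rho P * enthalpy \<gamma> P > 0"
    unfolding h using r p \<gamma> by (simp add: add_pos_pos)
  have D: "D = rho P * ?L" and m: "m = (rho P * enthalpy \<gamma> P * ?L\<^sup>2) *\<^sub>R vel P"
    and H: "H = rho P * enthalpy \<gamma> P * ?L\<^sup>2"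
    using W by (auto simp: cons_of_prim_def H_def)
  show Hpos: "H > 0" unfolding H using hpos L by simp
  show "D > 0" unfolding D using r L by simp
  show mH: "m = H *\<^sub>R vel P" using m H by simp
  have nm: "norm m = H * ?v" using mH Hpos by simp
  show "norm m < H" using nm v Hpos by simp
  have q: "norm m / H = ?v" using nm Hpos by simp
  show rD: "rho P = D * sqrt (1 - (norm m / H)\<^sup>2)"
    unfolding q D using L1 by (simp add: mult.assoc)
  have "H * (1 - ?v\<^sup>2) = rho P * enthalpy \<gamma> P"
    unfolding H using L2 by (simp add: mult.assoc)
  then have "H - (norm m)\<^sup>2 / H = rho P * enthalpy \<gamma> P"
    unfolding nm using Hpos by (simp add: power2_eq_square right_diff_distrib ac_simps)
  then show "D * sqrt (1 - (norm m / H)\<^sup>2) + \<gamma> / (\<gamma> - 1) * pres P = H - (norm m)\<^sup>2 / H"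
    using h rD by simp
qed

lemma pres_not_less:
  assumes P: "admissible_prim P" and Q: "admissible_prim Q" and \<gamma>: "1 < \<gamma>" "\<gamma> \<le> 2"
    and eq: "cons_of_prim \<gamma> P = cons_of_prim \<gamma> Q"
  shows "\<not> pres P < pres Q"
proof
  assume less: "pres P < pres Q"
  obtain D m e where W: "cons_of_prim \<gamma> P = (D, m, e)" by (cases "cons_of_prim \<gamma> P")
  then have W': "cons_of_prim \<gamma> Q = (D, m, e)" using eq by simp
  note p = cons_of_prim_eqs[OF P \<gamma>(1) W] and q = cons_of_prim_eqs[OF Q \<gamma>(1) W']
  define H where "H = e + pres P"
  define K where "K = e + pres Q"
  define k where "k = \<gamma> / (\<gamma> - 1)"
  have HK: "0 < H" "H < K" "0 < K" using p(1) less by (auto simp: H_def K_def)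
  have M: "norm m < H" "norm m < K" using p(4) q(4) by (auto simp: H_def K_def)
  have "norm m / K \<le> norm m / H" using HK by (simp add: frac_le)
  then have "(norm m / K)\<^sup>2 \<le> (norm m / H)\<^sup>2" using HK by (intro power_mono) auto
  then have s: "D * sqrt (1 - (norm m / H)\<^sup>2) \<le> D * sqrt (1 - (norm m / K)\<^sup>2)"
    using p(2) by simp
  have k: "2 \<le> k" using \<gamma> by (simp add: k_def field_simps)
  have "(norm m)\<^sup>2 < H * K"
    using M HK by (simp add: power2_eq_square mult_strict_mono)
  then have "(norm m)\<^sup>2 / (H * K) < 1" using HK by simp
  then have "(norm m)\<^sup>2 / (H * K) * (K - H) < 1 * (K - H)"
    using HK by (intro mult_strict_right_mono) auto
  moreover have "(norm m)\<^sup>2 / (H * K) * (K - H) = (norm m)\<^sup>2 / H - (norm m)\<^sup>2 / K"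
    using HK by (simp add: field_simps)
  ultimately have "(norm m)\<^sup>2 / H - (norm m)\<^sup>2 / K < K - H" by (simp only: mult_1)
  moreover have "D * sqrt (1 - (norm m / H)\<^sup>2) + k * pres P = H - (norm m)\<^sup>2 / H"
    "D * sqrt (1 - (norm m / K)\<^sup>2) + k * pres Q = K - (norm m)\<^sup>2 / K"
    using p(6) q(6) by (simp_all add: H_def K_def k_def)
  moreover have "2 * (K - H) \<le> k * (K - H)"
    using k HK by (intro mult_right_mono) auto
  moreover have "k * (K - H) = k * pres Q - k * pres P"
    by (simp add: H_def K_def right_diff_distrib)
  moreover have False
    if "mH - mK < K - H" "sH + pP = H - mH" "sK + pQ = K - mK" "2 * (K - H) \<le> kd"
      "kd = pQ - pP" "sH \<le> sK" for mH mK sH sK pP pQ kd :: real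
    using that HK by argo
  ultimately show False using s by blast
qed

lemma cons_of_prim_inj:
  assumes "admissible_prim P" "admissible_prim Q" "1 < \<gamma>" "\<gamma> \<le> 2"
    and eq: "cons_of_prim \<gamma> P = cons_of_prim \<gamma> Q"
  shows "P = Q"
proof -
  have pp: "pres P = pres Q"
    using pres_not_less[of P Q \<gamma>] pres_not_less[of Q P \<gamma>] assms by fastforce
  obtain D m e where W: "cons_of_prim \<gamma> P = (D, m, e)" by (cases "cons_of_prim \<gamma> P")
  then have W': "cons_of_prim \<gamma> Q = (D, m, e)" using eq by simp
  note p = cons_of_prim_eqs[OF assms(1,3) W] and q = cons_of_prim_eqs[OF assms(2,3) W']
  have "rho P = rho Q" using p(5) q(5) pp by simp
  moreover have "(e + pres P) *\<^sub>R vel P = (e + pres P) *\<^sub>R vel Q"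
    using p(3) q(3) by (simp only: pp)
  then have "vel P = vel Q" using p(1) by (metis less_irrefl scaleR_left_imp_eq)
  ultimately show ?thesis using pp by simp
qed

lemma prim_of_cons_of_prim:
  assumes "admissible_prim P" "1 < \<gamma>" "\<gamma> \<le> 2"
  shows "prim_of \<gamma> (cons_of_prim \<gamma> P) = P"
  unfolding prim_of_def using assms by (auto intro!: the_equality dest: cons_of_prim_inj)

definition current :: "(species \<Rightarrow> real) \<Rightarrow> (species \<Rightarrow> real) \<Rightarrow> state \<Rightarrow> real^3" where
  "current \<gamma> r U =
    (\<Sum>\<alpha>\<in>{Ion, Electron}. let P = prim_of (\<gamma> \<alpha>) (fluid_part \<alpha> U)
       in (r \<alpha> * rho P * lorentz P) *\<^sub>R vel P)"

definition source_fluid :: "(species \<Rightarrow> real) \<Rightarrow> (species \<Rightarrow> real) \<Rightarrow> species \<Rightarrow> state \<Rightarrow> fluid" where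
  "source_fluid \<gamma> r \<alpha> U =
    (let D = fst (fluid_part \<alpha> U); u = vel (prim_of (\<gamma> \<alpha>) (fluid_part \<alpha> U))
     in (0,
         (r \<alpha> * D) *\<^sub>R (E_field U + cross3 u (B_field U)),
         r \<alpha> * D * (u \<bullet> E_field U)))"

definition source :: "(species \<Rightarrow> real) \<Rightarrow> (species \<Rightarrow> real) \<Rightarrow> state \<Rightarrow> state" where
  "source \<gamma> r U =
    (source_fluid \<gamma> r Ion U, source_fluid \<gamma> r Electron U, (0, - current \<gamma> r U))"

definition flux_x :: "real \<Rightarrow> fluid \<Rightarrow> fluid" where
  "flux_x \<gamma> W =
    (case W of (D, m, e) \<Rightarrow> let P = prim_of \<gamma> W; u = vel P $ 1
     in (D * u, vector [m$1 * u + pres P, m$2 * u, m$3 * u], m$1))"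

definition flux_y :: "real \<Rightarrow> fluid \<Rightarrow> fluid" where
  "flux_y \<gamma> W =
    (case W of (D, m, e) \<Rightarrow> let P = prim_of \<gamma> W; u = vel P $ 2
     in (D * u, vector [m$1 * u, m$2 * u + pres P, m$3 * u], m$2))"

text \<open>
  A numerical fluid flux assigns to each grid function a value at every cell interface; the
  stencil is not restricted.  Consistency with the exact flux \<open>f\<close> of species \<open>\<alpha>\<close>: on a grid
  function that is constant and admissible, the numerical flux is the exact one.
\<close>

definition consistent_flux ::
  "(species \<Rightarrow> real) \<Rightarrow> species \<Rightarrow> (real \<Rightarrow> fluid \<Rightarrow> fluid) \<Rightarrow> (state grid \<Rightarrow> fluid grid) \<Rightarrow> bool"
where
  "consistent_flux \<gamma> \<alpha> f F \<longleftrightarrow>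
    (\<forall>V i j. admissible \<gamma> V \<longrightarrow> F (\<lambda>_ _. V) i j = f (\<gamma> \<alpha>) (fluid_part \<alpha> V))"

definition minmod :: "real \<Rightarrow> real \<Rightarrow> real \<Rightarrow> real" where
  "minmod a b c =
    (if sgn (b - a) = sgn (c - b) then sgn (b - a) * min \<bar>c - b\<bar> \<bar>b - a\<bar> else 0)"

definition minmod3 :: "real^3 \<Rightarrow> real^3 \<Rightarrow> real^3 \<Rightarrow> real^3" where
  "minmod3 a b c = (\<chi> k. minmod (a $ k) (b $ k) (c $ k))"

definition MinMod :: "maxwell \<Rightarrow> maxwell \<Rightarrow> maxwell \<Rightarrow> maxwell" where
  "MinMod a b c = (minmod3 (fst a) (fst b) (fst c), minmod3 (snd a) (snd b) (snd c))"

text \<open>Diagonal reconstructions at the vertex \<open>(i + 1/2, j + 1/2)\<close>.\<close>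

definition rec_SW :: "maxwell grid \<Rightarrow> maxwell grid" where
  "rec_SW M i j = M i j + (1/2) *\<^sub>R MinMod (M (i - 1) (j - 1)) (M i j) (M (i + 1) (j + 1))"

definition rec_SE :: "maxwell grid \<Rightarrow> maxwell grid" where
  "rec_SE M i j =
    M (i + 1) j + (1/2) *\<^sub>R MinMod (M (i + 2) (j - 1)) (M (i + 1) j) (M i (j + 1))"

definition rec_NE :: "maxwell grid \<Rightarrow> maxwell grid" where
  "rec_NE M i j =
    M (i + 1) (j + 1) + (1/2) *\<^sub>R MinMod (M (i + 2) (j + 2)) (M (i + 1) (j + 1)) (M i j)"

definition rec_NW :: "maxwell grid \<Rightarrow> maxwell grid" where
  "rec_NW M i j =
    M i (j + 1) + (1/2) *\<^sub>R MinMod (M (i - 1) (j + 2)) (M i (j + 1)) (M (i + 1) j)"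

definition Ez_vertex :: "maxwell grid \<Rightarrow> real grid" where
  "Ez_vertex M i j =
    (let (B_SW, E_SW) = rec_SW M i j; (B_SE, E_SE) = rec_SE M i j;
         (B_NE, E_NE) = rec_NE M i j; (B_NW, E_NW) = rec_NW M i j
     in 1/4 * (E_SW$3 + E_SE$3 + E_NE$3 + E_NW$3)
        + 1/4 * (B_SE$2 + B_NE$2 - B_SW$2 - B_NW$2)
        - 1/4 * (B_NW$1 + B_NE$1 - B_SW$1 - B_SE$1))"

definition Bz_vertex :: "maxwell grid \<Rightarrow> real grid" where
  "Bz_vertex M i j =
    (let (B_SW, E_SW) = rec_SW M i j; (B_SE, E_SE) = rec_SE M i j;
         (B_NE, E_NE) = rec_NE M i j; (B_NW, E_NW) = rec_NW M i j
     in 1/4 * (B_SW$3 + B_SE$3 + B_NE$3 + B_NW$3)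
        - 1/4 * (E_NW$1 + E_NE$1 - E_SW$1 - E_SE$1)
        + 1/4 * (E_SE$2 + E_NE$2 - E_SW$2 - E_NW$2))"

text \<open>One-dimensional traces at the interfaces \<open>(i + 1/2, j)\<close> and \<open>(i, j + 1/2)\<close>.\<close>

definition trace_x_minus :: "maxwell grid \<Rightarrow> maxwell grid" where
  "trace_x_minus M i j = M i j + (1/2) *\<^sub>R MinMod (M (i - 1) j) (M i j) (M (i + 1) j)"

definition trace_x_plus :: "maxwell grid \<Rightarrow> maxwell grid" where
  "trace_x_plus M i j =
    M (i + 1) j - (1/2) *\<^sub>R MinMod (M i j) (M (i + 1) j) (M (i + 2) j)"

definition trace_y_minus :: "maxwell grid \<Rightarrow> maxwell grid" where
  "trace_y_minus M i j = M i j + (1/2) *\<^sub>R MinMod (M i (j - 1)) (M i j) (M i (j + 1))"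

definition trace_y_plus :: "maxwell grid \<Rightarrow> maxwell grid" where
  "trace_y_plus M i j =
    M i (j + 1) - (1/2) *\<^sub>R MinMod (M i j) (M i (j + 1)) (M i (j + 2))"

text \<open>Value at the interface \<open>(i + 1/2, j)\<close>; \<open>Ez_vertex M i (j - 1)\<close> sits at \<open>(i + 1/2, j - 1/2)\<close>.\<close>

definition maxwell_flux_x :: "maxwell grid \<Rightarrow> maxwell grid" where
  "maxwell_flux_x M i j =
    (let (Bm, Em) = trace_x_minus M i j; (Bp, Ep) = trace_x_plus M i j
     in (vector [0,
                 - (1/2) * (Ez_vertex M i j + Ez_vertex M i (j - 1)),
                 1/2 * (Em$2 + Ep$2) - 1/2 * (Bp$3 - Bm$3)],
         vector [0,
                 1/2 * (Bz_vertex M i j + Bz_vertex M i (j - 1)),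
                 - (1/2) * (Bm$2 + Bp$2) - 1/2 * (Ep$3 - Em$3)]))"

text \<open>Value at the interface \<open>(i, j + 1/2)\<close>.\<close>

definition maxwell_flux_y :: "maxwell grid \<Rightarrow> maxwell grid" where
  "maxwell_flux_y M i j =
    (let (Bm, Em) = trace_y_minus M i j; (Bp, Ep) = trace_y_plus M i j
     in (vector [1/2 * (Ez_vertex M i j + Ez_vertex M (i - 1) j),
                 0,
                 - (1/2) * (Em$1 + Ep$1) - 1/2 * (Bp$3 - Bm$3)],
         vector [- (1/2) * (Bz_vertex M i j + Bz_vertex M (i - 1) j),
                 0,
                 1/2 * (Bm$1 + Bp$1) - 1/2 * (Ep$3 - Em$3)]))"

definition num_flux_x :: "(species \<Rightarrow> state grid \<Rightarrow> fluid grid) \<Rightarrow> state grid \<Rightarrow> state grid" where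
  "num_flux_x F U i j =
    (F Ion U i j, F Electron U i j, maxwell_flux_x (\<lambda>k l. maxwell_part (U k l)) i j)"

definition num_flux_y :: "(species \<Rightarrow> state grid \<Rightarrow> fluid grid) \<Rightarrow> state grid \<Rightarrow> state grid" where
  "num_flux_y F U i j =
    (F Ion U i j, F Electron U i j, maxwell_flux_y (\<lambda>k l. maxwell_part (U k l)) i j)"

definition spatial_op ::
  "(species \<Rightarrow> state grid \<Rightarrow> fluid grid) \<Rightarrow> (species \<Rightarrow> state grid \<Rightarrow> fluid grid)
    \<Rightarrow> real \<Rightarrow> real \<Rightarrow> state grid \<Rightarrow> state grid"
where
  "spatial_op Fx Fy \<Delta>x \<Delta>y U i j =
    - ((1 / \<Delta>x) *\<^sub>R (num_flux_x Fx U i j - num_flux_x Fx U (i - 1) j))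
    - ((1 / \<Delta>y) *\<^sub>R (num_flux_y Fy U i j - num_flux_y Fy U i (j - 1)))"

text \<open>Discrete divergence at the vertex \<open>(i + 1/2, j + 1/2)\<close>.\<close>

definition divergence :: "real \<Rightarrow> real \<Rightarrow> (real^3) grid \<Rightarrow> real grid" where
  "divergence \<Delta>x \<Delta>y A i j =
    1/2 * ((A (i + 1) (j + 1) $ 1 - A i (j + 1) $ 1) / \<Delta>x
           + (A (i + 1) j $ 1 - A i j $ 1) / \<Delta>x)
    + 1/2 * ((A (i + 1) (j + 1) $ 2 - A (i + 1) j $ 2) / \<Delta>y
           + (A i (j + 1) $ 2 - A i j $ 2) / \<Delta>y)"

end

theory Submission
  imports Defs
begin

text \<open>
  Both identities express that the discrete divergence of a discrete curl vanishes.  The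
  in-plane part of the Maxwell update in a cell is a centred difference, averaged in the
  transverse direction, of \<^emph>\<open>one\<close> scalar living on the vertices: \<open>Ez_vertex\<close> for the
  magnetic field and \<open>- Bz_vertex\<close> for the electric field.  In terms of the vertex-to-cell
  and cell-to-vertex averages and differences in \<open>x\<close> and \<open>y\<close>, this is the discrete curl
  \<open>(- \<partial>\<^sub>y, \<partial>\<^sub>x)\<close> of that scalar, and the discrete divergence is built from the same
  averages and differences.  These operators commute, so the divergence of the curl of
  any vertex function cancels (\<open>divergence_curl_eq_0\<close>).

  As the divergence is linear, taking it of the last stage of the scheme annihilates both
  spatial terms and leaves the divergence of the sources: nothing for the magnetic field,
  and the mean of the two stage currents, with a minus sign, for the electric field.  The
  divergence at a vertex only sees the four adjacent cells
  (\<open>divergence_cong\<close>), all of them cells of the mesh for the vertices in question, so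
  the last stage holds wherever it is applied.  The curl identity has no such restriction:
  it is an identity for grid functions, with arbitrary ghost values.
\<close>

lemma divergence_cong:
  assumes "A i j = A' i j" "A (i + 1) j = A' (i + 1) j"
    and "A i (j + 1) = A' i (j + 1)" "A (i + 1) (j + 1) = A' (i + 1) (j + 1)"
  shows "divergence \<Delta>x \<Delta>y A i j = divergence \<Delta>x \<Delta>y A' i j"
  using assms by (simp add: divergence_def)

lemma divergence_add:
  "divergence \<Delta>x \<Delta>y (\<lambda>k l. A k l + A' k l) i j
    = divergence \<Delta>x \<Delta>y A i j + divergence \<Delta>x \<Delta>y A' i j"
  by (simp add: divergence_def diff_divide_distrib add_divide_distrib algebra_simps)

lemma divergence_scaleR:
  "divergence \<Delta>x \<Delta>y (\<lambda>k l. s *\<^sub>R A k l) i j = s * divergence \<Delta>x \<Delta>y A i j"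
  by (simp add: divergence_def diff_divide_distrib add_divide_distrib algebra_simps)

lemma divergence_minus:
  "divergence \<Delta>x \<Delta>y (\<lambda>k l. - A k l) i j = - divergence \<Delta>x \<Delta>y A i j"
  using divergence_scaleR[of \<Delta>x \<Delta>y "-1" A i j] by simp

lemma divergence_zero: "divergence \<Delta>x \<Delta>y (\<lambda>k l. 0) i j = 0"
  by (simp add: divergence_def)

text \<open>
  The vertices around cell \<open>(k, l)\<close> carry the indices \<open>k - 1, k\<close> and \<open>l - 1, l\<close>, so the
  components below are difference quotients for \<open>- \<partial>\<^sub>y \<Phi>\<close> and \<open>\<partial>\<^sub>x \<Phi>\<close> along the cell edges,
  averaged over the two parallel edges.
  At a given vertex the divergence gathers \<open>\<Phi>\<close> on a \<open>3 \<times> 3\<close> block of vertices; the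
  weight of each of these values is a multiple of \<open>1 / (\<Delta>x \<Delta>y)\<close> that receives opposite
  contributions from the two components.
\<close>

lemma divergence_curl_eq_0:
  fixes \<Phi> :: "real grid"
  assumes A1: "\<And>k l. A k l $ 1 =
      - ((\<Phi> k l + \<Phi> (k - 1) l - \<Phi> k (l - 1) - \<Phi> (k - 1) (l - 1)) / (2 * \<Delta>y))"
    and A2: "\<And>k l. A k l $ 2 =
      (\<Phi> k l + \<Phi> k (l - 1) - \<Phi> (k - 1) l - \<Phi> (k - 1) (l - 1)) / (2 * \<Delta>x)"
  shows "divergence \<Delta>x \<Delta>y A i j = 0"
  unfolding divergence_def A1 A2
  by (simp add: diff_divide_distrib add_divide_distrib algebra_simps)

lemma B_field_add: "B_field (U + V) = B_field U + B_field V"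
  by (simp add: B_field_def maxwell_part_def)

lemma B_field_scaleR: "B_field (s *\<^sub>R U) = s *\<^sub>R B_field U"
  by (simp add: B_field_def maxwell_part_def)

lemma E_field_add: "E_field (U + V) = E_field U + E_field V"
  by (simp add: E_field_def maxwell_part_def)

lemma E_field_scaleR: "E_field (s *\<^sub>R U) = s *\<^sub>R E_field U"
  by (simp add: E_field_def maxwell_part_def)

lemma B_field_source: "B_field (source \<gamma> r U) = 0"
  by (simp add: B_field_def maxwell_part_def source_def)

lemma E_field_source: "E_field (source \<gamma> r U) = - current \<gamma> r U"
  by (simp add: E_field_def maxwell_part_def source_def)

text \<open>
  Faraday's law: the \<open>y\<close>-flux of \<open>B\<^sub>x\<close> and the \<open>x\<close>-flux of \<open>B\<^sub>y\<close> are averages of the same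
  vertex values of \<open>E\<^sub>z\<close> with opposite signs, which makes the in-plane update a curl.
\<close>

lemma divergence_B_spatial_op:
  "divergence \<Delta>x \<Delta>y (\<lambda>k l. B_field (spatial_op Fx Fy \<Delta>x \<Delta>y U k l)) i j = 0"
  by (rule divergence_curl_eq_0[where \<Phi> = "Ez_vertex (\<lambda>k l. maxwell_part (U k l))"])
    (simp_all add: B_field_def maxwell_part_def spatial_op_def num_flux_x_def
      num_flux_y_def maxwell_flux_x_def maxwell_flux_y_def split_beta vector_3
      diff_divide_distrib add_divide_distrib)

text \<open>The curl part of Ampere's law, in which \<open>B\<^sub>z\<close> takes the role of \<open>- E\<^sub>z\<close>.\<close>

lemma divergence_E_spatial_op:
  "divergence \<Delta>x \<Delta>y (\<lambda>k l. E_field (spatial_op Fx Fy \<Delta>x \<Delta>y U k l)) i j = 0"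
  by (rule divergence_curl_eq_0
        [where \<Phi> = "\<lambda>k l. - Bz_vertex (\<lambda>k l. maxwell_part (U k l)) k l"])
    (simp_all add: E_field_def maxwell_part_def spatial_op_def num_flux_x_def
      num_flux_y_def maxwell_flux_x_def maxwell_flux_y_def split_beta vector_3
      diff_divide_distrib add_divide_distrib)

theorem proposition4p2:
  fixes \<gamma> r :: "species \<Rightarrow> real"
    and a b c d \<Delta>x \<Delta>y \<Delta>t \<beta> :: real
    and Nx Ny :: nat
    and Fx Fy :: "species \<Rightarrow> state grid \<Rightarrow> fluid grid"
    and Uold U1 U2 Unew :: "state grid"
  assumes "\<And>\<alpha>. 1 < \<gamma> \<alpha> \<and> \<gamma> \<alpha> \<le> 2"
    and "a < b" "c < d" "0 < Nx" "0 < Ny"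
    and "\<Delta>x = (b - a) / real Nx" "\<Delta>y = (d - c) / real Ny"
    and "\<beta> = 1 - 1 / sqrt 2" "\<Delta>t > 0"
    and "\<And>\<alpha>. consistent_flux \<gamma> \<alpha> flux_x (Fx \<alpha>)"
    and "\<And>\<alpha>. consistent_flux \<gamma> \<alpha> flux_y (Fy \<alpha>)"
    and "\<And>i j. 0 \<le> i \<Longrightarrow> i < int Nx \<Longrightarrow> 0 \<le> j \<Longrightarrow> j < int Ny \<Longrightarrow>
           admissible \<gamma> (Uold i j) \<and> admissible \<gamma> (U1 i j) \<and> admissible \<gamma> (U2 i j)"
    and "\<And>i j. 0 \<le> i \<Longrightarrow> i < int Nx \<Longrightarrow> 0 \<le> j \<Longrightarrow> j < int Ny \<Longrightarrow>
           U1 i j = Uold i j + (\<Delta>t * \<beta>) *\<^sub>R source \<gamma> r (U1 i j)"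
    and "\<And>i j. 0 \<le> i \<Longrightarrow> i < int Nx \<Longrightarrow> 0 \<le> j \<Longrightarrow> j < int Ny \<Longrightarrow>
           U2 i j = Uold i j + \<Delta>t *\<^sub>R
             (spatial_op Fx Fy \<Delta>x \<Delta>y U1 i j
              + (1 - 2 * \<beta>) *\<^sub>R source \<gamma> r (U1 i j) + \<beta> *\<^sub>R source \<gamma> r (U2 i j))"
    and "\<And>i j. 0 \<le> i \<Longrightarrow> i < int Nx \<Longrightarrow> 0 \<le> j \<Longrightarrow> j < int Ny \<Longrightarrow>
           Unew i j = Uold i j + (1/2 * \<Delta>t) *\<^sub>R
             (spatial_op Fx Fy \<Delta>x \<Delta>y U1 i j + spatial_op Fx Fy \<Delta>x \<Delta>y U2 i j
              + source \<gamma> r (U1 i j) + source \<gamma> r (U2 i j))"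
  shows "\<forall>i j. 0 \<le> i \<and> i \<le> int Nx - 2 \<and> 0 \<le> j \<and> j \<le> int Ny - 2 \<longrightarrow>
      divergence \<Delta>x \<Delta>y (\<lambda>k l. B_field (Unew k l)) i j
        = divergence \<Delta>x \<Delta>y (\<lambda>k l. B_field (Uold k l)) i j
    \<and> divergence \<Delta>x \<Delta>y (\<lambda>k l. E_field (Unew k l)) i j
        = divergence \<Delta>x \<Delta>y (\<lambda>k l. E_field (Uold k l)) i j
          - \<Delta>t / 2 * (divergence \<Delta>x \<Delta>y (\<lambda>k l. current \<gamma> r (U1 k l)) i j
                    + divergence \<Delta>x \<Delta>y (\<lambda>k l. current \<gamma> r (U2 k l)) i j)"
proof (intro allI impI)
  fix i j :: int
  assume ij: "0 \<le> i \<and> i \<le> int Nx - 2 \<and> 0 \<le> j \<and> j \<le> int Ny - 2"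
  note step = assms(15)
  let ?L1 = "spatial_op Fx Fy \<Delta>x \<Delta>y U1" and ?L2 = "spatial_op Fx Fy \<Delta>x \<Delta>y U2"
  let ?V = "\<lambda>k l. Uold k l + (1/2 * \<Delta>t) *\<^sub>R
    (?L1 k l + ?L2 k l + source \<gamma> r (U1 k l) + source \<gamma> r (U2 k l))"
  \<comment> \<open>The bounds on the vertex put all four adjacent cells inside the mesh.\<close>
  have new: "Unew i j = ?V i j" "Unew (i + 1) j = ?V (i + 1) j"
      "Unew i (j + 1) = ?V i (j + 1)" "Unew (i + 1) (j + 1) = ?V (i + 1) (j + 1)"
    using ij by (simp_all add: step)
  have "divergence \<Delta>x \<Delta>y (\<lambda>k l. B_field (Unew k l)) i j
      = divergence \<Delta>x \<Delta>y (\<lambda>k l. B_field (?V k l)) i j"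
    by (rule divergence_cong) (simp_all only: new)
  also have "\<dots> = divergence \<Delta>x \<Delta>y (\<lambda>k l. B_field (Uold k l)) i j"
    by (simp only: B_field_add B_field_scaleR B_field_source divergence_add
        divergence_scaleR divergence_B_spatial_op divergence_zero)
      simp
  finally have B: "divergence \<Delta>x \<Delta>y (\<lambda>k l. B_field (Unew k l)) i j
      = divergence \<Delta>x \<Delta>y (\<lambda>k l. B_field (Uold k l)) i j" .
  have "divergence \<Delta>x \<Delta>y (\<lambda>k l. E_field (Unew k l)) i j
      = divergence \<Delta>x \<Delta>y (\<lambda>k l. E_field (?V k l)) i j"
    by (rule divergence_cong) (simp_all only: new)
  also have "\<dots> = divergence \<Delta>x \<Delta>y (\<lambda>k l. E_field (Uold k l)) i j
      - \<Delta>t / 2 * (divergence \<Delta>x \<Delta>y (\<lambda>k l. current \<gamma> r (U1 k l)) i j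
                + divergence \<Delta>x \<Delta>y (\<lambda>k l. current \<gamma> r (U2 k l)) i j)"
    by (simp only: E_field_add E_field_scaleR E_field_source divergence_add
        divergence_scaleR divergence_minus divergence_E_spatial_op)
      (simp add: algebra_simps)
  finally show "divergence \<Delta>x \<Delta>y (\<lambda>k l. B_field (Unew k l)) i j
        = divergence \<Delta>x \<Delta>y (\<lambda>k l. B_field (Uold k l)) i j
    \<and> divergence \<Delta>x \<Delta>y (\<lambda>k l. E_field (Unew k l)) i j
        = divergence \<Delta>x \<Delta>y (\<lambda>k l. E_field (Uold k l)) i j
          - \<Delta>t / 2 * (divergence \<Delta>x \<Delta>y (\<lambda>k l. current \<gamma> r (U1 k l)) i j
                    + divergence \<Delta>x \<Delta>y (\<lambda>k l. current \<gamma> r (U2 k l)) i j)"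
    using B by simp
qed

end
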